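(* Let $p,q\ge1$ and let $\Sigma\subset\mathbb{Z}^N$ be simply connected. Let $f=s^+\oplus s^-:\Sigma\to\mathcal{Z}$ be an applicable Legendre map spanned by an isotropic Darboux pair of isothermic nets and set $s:=s^+\sqcup s^-:\{0,1\}\times\Sigma\to\mathcal{Q}$. Let $m\in\mathbb{R}^\times$ be distinct from any $m_{ij}$ of $s$ and let $\hat{s}=\hat{s}^+\sqcup\hat{s}^-$ be a Darboux transform of $s$ with parameter $m$. Then $\hat{f}:=\hat{s}^+\oplus\hat{s}^-$ is an applicable Legendre map.
   Context: Domain: an edge $ij$ of $\Sigma\subset\mathbb{Z}^N$ is a pair of points of $\Sigma$ differing by a standard unit vector; a quadrilateral is an elementary square with all four vertices $i,j,k,\ell$ (in cyclic order) in $\Sigma$. $\Sigma$ is simply connected if any two points are joined by an edge-path in $\Sigma$ and any two edge-paths in $\Sigma$ with the same end-points are related by finitely many moves: (a) replace $i$ by $(iji)$ or conversely, $ij$ an edge; (b) replace $(k\ell i)$ by $(kji)$ on a quadrilateral. A vector-valued $1$-form $\alpha$ assigns $\alpha_{ji}=-\alpha_{ij}$ to each oriented edge from $i$ to $j$; it is closed if $\alpha_{i\ell}+\alpha_{\ell k}+\alpha_{kj}+\alpha_{ji}=0$ on every quadrilateral. $\mathbb{R}^{p+1,q+1}$ has a non-degenerate symmetric bilinear form $(\cdot,\cdot)$ of signature $(p+1,q+1)$, light cone $\mathcal{L}$ and quadric $\mathcal{Q}=\mathbb{P}(\mathcal{L})$; $\mathcal{Z}$ is the set of totally null $2$-planes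 in $\mathbb{R}^{p+1,q+1}$. Isothermic nets: a map $s:\Sigma\to\mathcal{Q}$ (null line subbundle) is regular if on each quadrilateral $s_i,s_j,s_k,s_\ell$ are pairwise distinct, $\dim(s_i+s_j+s_k+s_\ell)\ge3$, and $s_i\not\perp s_k$, $s_j\not\perp s_\ell$. An isothermic net $(s,\eta)$ is a regular $s$ with a closed, never-zero $\Lambda^2\mathbb{R}^{p+1,q+1}$-valued $1$-form $\eta$ with $\eta_{ji}\in s_j\wedge s_i$ on each edge. A Moutard lift of $(s,\eta)$ is a never-zero section $\mu$ of $s$ with $\eta_{ji}=\mu_j\wedge\mu_i$; the edge-labelling is $m_{ij}=1/(\mu_i,\mu_j)\in\mathbb{R}^\times\cup\{\infty\}$. All this applies also to nets on $\{0,1\}\times\Sigma\subset\mathbb{Z}^{N+1}$. Given nets $u,v$ on a domain $D$, $u\sqcup v:\{0,1\}\times D\to\mathcal{Q}$ equals $u$ on $\{0\}\times D$ and $v$ on $\{1\}\times D$. Isothermic nets $(u,\eta^u),(v,\eta^v)$ on $D$ are a Darboux pair with parameter $m\in\mathbb{R}^\times\cup\{\infty\}$ ($v$ is a Darboux transform of $u$ with parameter $m$) if $u\sqcup v$ is isothermic with a $1$-form restricting to $\eta^u$ and $\eta^v$ on the two copies of $D$ and the edge-label of every vertical edge $\{0,1\}\times\{i\}$ is $m$. It is isotropic if $m=\infty$ (so $u_i\perp v_i$). An isotropic Darboux pair $(s^\pm,\eta^\pm)$ makes $s=s^+\sqcup s^-$ an isothermic net on $\{0,1\}\times\Sigma$;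 its labels $m_{ij}$ (including those on vertical edges) are meant in the claim. Legendre maps: $f:\Sigma\to\mathcal{Z}$ with $f_i\cap f_j\ne\{0\}$ on each edge. Regular: (i) on each edge $f_{ij}:=f_i+f_j$ is $3$-dimensional, so $s_{ij}:=f_i\cap f_j$ is $1$-dimensional; (ii) on each quadrilateral $s_{ij}\wedge s_{jk}\wedge s_{k\ell}\wedge s_{\ell i}\ne\{0\}$. A regular $f$ is applicable if there is a closed $\Lambda^2\mathbb{R}^{p+1,q+1}$-valued $1$-form $\eta$ with $\eta_{ij}\in\Lambda^2f_{ij}$ and $\eta_{ij}\wedge s_{ij}\ne\{0\}$ on each edge. Regularity is a standing assumption imposed on all Legendre maps considered, including $\hat f$. *)

theory Defs
  imports "HOL-Analysis.Analysis"
begin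

section \<open>Lattice domains\<close>

text \<open>
  Points of \<open>\<int>\<^sup>N\<close> are integer lists of length \<open>N\<close>, so that \<open>{0,1} \<times> D \<subseteq> \<int>\<^sup>N\<^sup>+\<^sup>1\<close> is obtained from
  \<open>D \<subseteq> \<int>\<^sup>N\<close> by consing a new first coordinate.
\<close>

type_synonym point = "int list"

definition lattice :: "nat \<Rightarrow> point set" where
  "lattice N = {x. length x = N}"

definition shift :: "nat \<Rightarrow> int \<Rightarrow> point \<Rightarrow> point" where
  "shift a t x = x[a := x ! a + t]"

definition edge :: "point set \<Rightarrow> point \<Rightarrow> point \<Rightarrow> bool" where
  "edge D i j \<longleftrightarrow> i \<in> D \<and> j \<in> D \<and> (\<exists>a < length i. \<exists>\<sigma> \<in> {1, -1}. j = shift a \<sigma> i)"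

text \<open>The two signs make the following hold for every cyclic labelling of an elementary square,
  starting at any vertex and running in either direction.\<close>

definition quadrilateral :: "point set \<Rightarrow> point \<Rightarrow> point \<Rightarrow> point \<Rightarrow> point \<Rightarrow> bool" where
  "quadrilateral D i j k l \<longleftrightarrow> i \<in> D \<and> j \<in> D \<and> k \<in> D \<and> l \<in> D \<and>
     (\<exists>a < length i. \<exists>b < length i. a \<noteq> b \<and> (\<exists>\<sigma> \<in> {1, -1}. \<exists>\<tau> \<in> {1, -1}.
        j = shift a \<sigma> i \<and> l = shift b \<tau> i \<and> k = shift b \<tau> (shift a \<sigma> i)))"

definition edge_path :: "point set \<Rightarrow> point list \<Rightarrow> bool" where
  "edge_path D \<gamma> \<longleftrightarrow> \<gamma> \<noteq> [] \<and> set \<gamma> \<subseteq> D \<and> successively (edge D) \<gamma>"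

inductive path_move :: "point set \<Rightarrow> point list \<Rightarrow> point list \<Rightarrow> bool" for D where
  backtrack: "edge D i j \<Longrightarrow> path_move D (\<gamma> @ [i] @ \<delta>) (\<gamma> @ [i, j, i] @ \<delta>)"
| flip: "quadrilateral D i j k l \<Longrightarrow> path_move D (\<gamma> @ [k, l, i] @ \<delta>) (\<gamma> @ [k, j, i] @ \<delta>)"

definition simply_connected_domain :: "point set \<Rightarrow> bool" where
  "simply_connected_domain D \<longleftrightarrow>
     (\<forall>x \<in> D. \<forall>y \<in> D. \<exists>\<gamma>. edge_path D \<gamma> \<and> hd \<gamma> = x \<and> last \<gamma> = y) \<and>
     (\<forall>\<gamma> \<delta>. edge_path D \<gamma> \<and> edge_path D \<delta> \<and> hd \<gamma> = hd \<delta> \<and> last \<gamma> = last \<delta> \<longrightarrow>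
        equivclp (path_move D) \<gamma> \<delta>)"

definition double :: "point set \<Rightarrow> point set" where
  "double D = {t # i | t i. t \<in> {0, 1} \<and> i \<in> D}"

definition join_net :: "(point \<Rightarrow> 'b) \<Rightarrow> (point \<Rightarrow> 'b) \<Rightarrow> point \<Rightarrow> 'b" (infixl \<open>\<squnion>\<^sub>n\<close> 65) where
  "(u \<squnion>\<^sub>n v) x = (if hd x = 0 then u (tl x) else v (tl x))"

text \<open>The value \<open>\<alpha>\<^sub>j\<^sub>i\<close> of a 1-form on the oriented edge from \<open>i\<close> to \<open>j\<close> is \<open>\<alpha> j i\<close>.\<close>

definition one_form :: "point set \<Rightarrow> (point \<Rightarrow> point \<Rightarrow> 'v::real_vector) \<Rightarrow> bool" where
  "one_form D \<alpha> \<longleftrightarrow> (\<forall>i j. edge D i j \<longrightarrow> \<alpha> j i = - \<alpha> i j)"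

definition closed_form :: "point set \<Rightarrow> (point \<Rightarrow> point \<Rightarrow> 'v::real_vector) \<Rightarrow> bool" where
  "closed_form D \<alpha> \<longleftrightarrow> one_form D \<alpha> \<and>
     (\<forall>i j k l. quadrilateral D i j k l \<longrightarrow> \<alpha> i l + \<alpha> l k + \<alpha> k j + \<alpha> j i = 0)"


section \<open>Multilinear algebra of \<open>\<real>\<^sup>p\<^sup>+\<^sup>1\<^sup>,\<^sup>q\<^sup>+\<^sup>1\<close>\<close>

text \<open>Signature \<open>(m, n)\<close>, in particular non-degeneracy, via an orthonormal basis \<open>P \<union> Q\<close>.\<close>

definition has_signature :: "(real^'n \<Rightarrow> real^'n \<Rightarrow> real) \<Rightarrow> nat \<Rightarrow> nat \<Rightarrow> bool" where
  "has_signature B m n \<longleftrightarrow> bilinear B \<and> (\<forall>x y. B x y = B y x) \<and>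
     (\<exists>P Q. independent (P \<union> Q) \<and> span (P \<union> Q) = UNIV \<and> card P = m \<and> card Q = n \<and>
        pairwise (\<lambda>x y. B x y = 0) (P \<union> Q) \<and> (\<forall>x \<in> P. B x x = 1) \<and> (\<forall>x \<in> Q. B x x = -1))"

text \<open>
  \<open>\<Lambda>\<^sup>k\<real>\<^sup>n\<close> is realised as the space of alternating \<open>k\<close>-tensors: the components of
  \<open>v\<^sub>1 \<and> \<dots> \<and> v\<^sub>k\<close> are the \<open>k \<times> k\<close> minors of the matrix with columns \<open>v\<^sub>1, \<dots>, v\<^sub>k\<close>.
  \<open>wedge2v\<close> and \<open>wedge3v\<close> are the products \<open>\<Lambda>\<^sup>2 \<times> \<Lambda>\<^sup>1 \<rightarrow> \<Lambda>\<^sup>3\<close> and \<open>\<Lambda>\<^sup>3 \<times> \<Lambda>\<^sup>1 \<rightarrow> \<Lambda>\<^sup>4\<close>.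
\<close>

definition wedge :: "real^'n \<Rightarrow> real^'n \<Rightarrow> real^'n^'n" where
  "wedge v w = (\<chi> a b. v $ a * w $ b - v $ b * w $ a)"

definition wedge2v :: "real^'n^'n \<Rightarrow> real^'n \<Rightarrow> real^'n^'n^'n" where
  "wedge2v \<alpha> v = (\<chi> a b c. \<alpha> $ a $ b * v $ c - \<alpha> $ a $ c * v $ b + \<alpha> $ b $ c * v $ a)"

definition wedge3v :: "real^'n^'n^'n \<Rightarrow> real^'n \<Rightarrow> real^'n^'n^'n^'n" where
  "wedge3v \<beta> v = (\<chi> a b c d. \<beta> $ a $ b $ c * v $ d - \<beta> $ a $ b $ d * v $ c
                            + \<beta> $ a $ c $ d * v $ b - \<beta> $ b $ c $ d * v $ a)"

definition subspace_wedge :: "(real^'n) set \<Rightarrow> (real^'n) set \<Rightarrow> (real^'n^'n) set" where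
  "subspace_wedge U W = span {wedge u w | u w. u \<in> U \<and> w \<in> W}"

definition perp :: "(real^'n \<Rightarrow> real^'n \<Rightarrow> real) \<Rightarrow> (real^'n) set \<Rightarrow> (real^'n) set \<Rightarrow> bool" where
  "perp B U W \<longleftrightarrow> (\<forall>u \<in> U. \<forall>w \<in> W. B u w = 0)"

definition null_lines :: "(real^'n \<Rightarrow> real^'n \<Rightarrow> real) \<Rightarrow> (real^'n) set set" where
  "null_lines B = {L. subspace L \<and> dim L = 1 \<and> (\<forall>v \<in> L. B v v = 0)}"

definition null_planes :: "(real^'n \<Rightarrow> real^'n \<Rightarrow> real) \<Rightarrow> (real^'n) set set" where
  "null_planes B = {P. subspace P \<and> dim P = 2 \<and> perp B P P}"


section \<open>Isothermic nets and Darboux pairs\<close>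

text \<open>Sums of subspaces are written with the elementwise \<open>+\<close> on sets.\<close>

definition regular_net ::
  "(real^'n \<Rightarrow> real^'n \<Rightarrow> real) \<Rightarrow> point set \<Rightarrow> (point \<Rightarrow> (real^'n) set) \<Rightarrow> bool" where
  "regular_net B D s \<longleftrightarrow> (\<forall>i \<in> D. s i \<in> null_lines B) \<and>
     (\<forall>i j k l. quadrilateral D i j k l \<longrightarrow>
        distinct [s i, s j, s k, s l] \<and> dim (s i + s j + s k + s l) \<ge> 3 \<and>
        \<not> perp B (s i) (s k) \<and> \<not> perp B (s j) (s l))"

definition isothermic_net ::
  "(real^'n \<Rightarrow> real^'n \<Rightarrow> real) \<Rightarrow> point set \<Rightarrow> (point \<Rightarrow> (real^'n) set) \<Rightarrow>
   (point \<Rightarrow> point \<Rightarrow> real^'n^'n) \<Rightarrow> bool" where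
  "isothermic_net B D s \<eta> \<longleftrightarrow> regular_net B D s \<and> closed_form D \<eta> \<and>
     (\<forall>i j. edge D i j \<longrightarrow> \<eta> j i \<noteq> 0 \<and> \<eta> j i \<in> subspace_wedge (s j) (s i))"

definition moutard_lift ::
  "point set \<Rightarrow> (point \<Rightarrow> (real^'n) set) \<Rightarrow> (point \<Rightarrow> point \<Rightarrow> real^'n^'n) \<Rightarrow>
   (point \<Rightarrow> real^'n) \<Rightarrow> bool" where
  "moutard_lift D s \<eta> \<mu> \<longleftrightarrow> (\<forall>i \<in> D. \<mu> i \<in> s i \<and> \<mu> i \<noteq> 0) \<and>
     (\<forall>i j. edge D i j \<longrightarrow> \<eta> j i = wedge (\<mu> j) (\<mu> i))"

text \<open>
  Edge labels take values in \<open>\<real>\<^sup>\<times> \<union> {\<infinity>}\<close>, embedded in \<open>ereal\<close>, where \<open>1 / 0 = \<infinity>\<close>.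
  The label of an edge does not depend on the Moutard lift used to compute it, because a lift
  is determined on an edge up to \<open>(\<mu>\<^sub>i, \<mu>\<^sub>j) \<mapsto> (r \<mu>\<^sub>i, r\<^sup>-\<^sup>1 \<mu>\<^sub>j)\<close>.
\<close>

definition has_label ::
  "(real^'n \<Rightarrow> real^'n \<Rightarrow> real) \<Rightarrow> point set \<Rightarrow> (point \<Rightarrow> (real^'n) set) \<Rightarrow>
   (point \<Rightarrow> point \<Rightarrow> real^'n^'n) \<Rightarrow> point \<Rightarrow> point \<Rightarrow> ereal \<Rightarrow> bool" where
  "has_label B D s \<eta> i j m \<longleftrightarrow>
     (\<exists>\<mu>. moutard_lift D s \<eta> \<mu> \<and> m = 1 / ereal (B (\<mu> i) (\<mu> j)))"

definition darboux_pair_via ::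
  "(real^'n \<Rightarrow> real^'n \<Rightarrow> real) \<Rightarrow> point set \<Rightarrow>
   (point \<Rightarrow> (real^'n) set) \<Rightarrow> (point \<Rightarrow> point \<Rightarrow> real^'n^'n) \<Rightarrow>
   (point \<Rightarrow> (real^'n) set) \<Rightarrow> (point \<Rightarrow> point \<Rightarrow> real^'n^'n) \<Rightarrow>
   ereal \<Rightarrow> (point \<Rightarrow> point \<Rightarrow> real^'n^'n) \<Rightarrow> bool" where
  "darboux_pair_via B D u \<eta>u v \<eta>v m \<eta> \<longleftrightarrow>
     isothermic_net B D u \<eta>u \<and> isothermic_net B D v \<eta>v \<and>
     isothermic_net B (double D) (u \<squnion>\<^sub>n v) \<eta> \<and>
     (\<forall>i j. edge D i j \<longrightarrow> \<eta> (0 # j) (0 # i) = \<eta>u j i \<and> \<eta> (1 # j) (1 # i) = \<eta>v j i) \<and>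
     (\<forall>i \<in> D. has_label B (double D) (u \<squnion>\<^sub>n v) \<eta> (0 # i) (1 # i) m)"

definition darboux_pair ::
  "(real^'n \<Rightarrow> real^'n \<Rightarrow> real) \<Rightarrow> point set \<Rightarrow>
   (point \<Rightarrow> (real^'n) set) \<Rightarrow> (point \<Rightarrow> point \<Rightarrow> real^'n^'n) \<Rightarrow>
   (point \<Rightarrow> (real^'n) set) \<Rightarrow> (point \<Rightarrow> point \<Rightarrow> real^'n^'n) \<Rightarrow> ereal \<Rightarrow> bool" where
  "darboux_pair B D u \<eta>u v \<eta>v m \<longleftrightarrow> (\<exists>\<eta>. darboux_pair_via B D u \<eta>u v \<eta>v m \<eta>)"


section \<open>Legendre maps\<close>

definition legendre_map ::
  "(real^'n \<Rightarrow> real^'n \<Rightarrow> real) \<Rightarrow> point set \<Rightarrow> (point \<Rightarrow> (real^'n) set) \<Rightarrow> bool" where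
  "legendre_map B D f \<longleftrightarrow> (\<forall>i \<in> D. f i \<in> null_planes B) \<and>
     (\<forall>i j. edge D i j \<longrightarrow> f i \<inter> f j \<noteq> {0})"

definition legendre_regular :: "point set \<Rightarrow> (point \<Rightarrow> (real^'n) set) \<Rightarrow> bool" where
  "legendre_regular D f \<longleftrightarrow>
     (\<forall>i j. edge D i j \<longrightarrow> dim (f i + f j) = 3) \<and>
     (\<forall>i j k l. quadrilateral D i j k l \<longrightarrow>
        {wedge3v (wedge2v (wedge a b) c) d | a b c d.
           a \<in> f i \<inter> f j \<and> b \<in> f j \<inter> f k \<and> c \<in> f k \<inter> f l \<and> d \<in> f l \<inter> f i} \<noteq> {0})"

definition applicable_legendre_map ::
  "(real^'n \<Rightarrow> real^'n \<Rightarrow> real) \<Rightarrow> point set \<Rightarrow> (point \<Rightarrow> (real^'n) set) \<Rightarrow> bool" where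
  "applicable_legendre_map B D f \<longleftrightarrow> legendre_map B D f \<and> legendre_regular D f \<and>
     (\<exists>\<eta>. closed_form D \<eta> \<and>
        (\<forall>i j. edge D i j \<longrightarrow>
           \<eta> i j \<in> subspace_wedge (f i + f j) (f i + f j) \<and>
           wedge2v (\<eta> i j) ` (f i \<inter> f j) \<noteq> {0}))"

end

theory Submission
  imports Defs
begin

text \<open>
  A Moutard lift \<open>\<mu>\<close> turns closedness of the \<open>1\<close>-form of an isothermic net into the Moutard
  equation: on a quadrilateral the diagonals \<open>\<mu>\<^sub>k - \<mu>\<^sub>i\<close> and \<open>\<mu>\<^sub>j - \<mu>\<^sub>l\<close> are proportional
  (\<open>moutard_equation\<close>). Because \<open>\<mu>\<close> is null, it follows that \<open>(\<mu>, \<mu>)\<close> takes equal values on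
  opposite edges (\<open>moutard_opposite_edges\<close>).

  Write \<open>\<mu>\<^sup>\<plusminus>\<close> and \<open>\<nu>\<^sup>\<plusminus>\<close> for the lifts of \<open>s\<^sup>\<plusminus>\<close> and of its Darboux transform, obtained by
  restricting one lift of \<open>s \<squnion> s'\<close>. The quadrilateral with vertices \<open>\<mu>\<^sup>+\<^sub>i, \<mu>\<^sup>-\<^sub>i, \<nu>\<^sup>-\<^sub>i, \<nu>\<^sup>+\<^sub>i\<close> gives
  \<open>(\<nu>\<^sup>+\<^sub>i, \<nu>\<^sup>-\<^sub>i) = (\<mu>\<^sup>+\<^sub>i, \<mu>\<^sup>-\<^sub>i) = 0\<close>, so \<open>f'\<^sub>i\<close> is totally null. On an edge \<open>ij\<close> of \<open>\<Sigma>\<close> the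
  quadrilateral with vertices \<open>\<nu>\<^sup>+\<^sub>i, \<nu>\<^sup>+\<^sub>j, \<nu>\<^sup>-\<^sub>j, \<nu>\<^sup>-\<^sub>i\<close> gives
  \<open>\<nu>\<^sup>-\<^sub>j - \<nu>\<^sup>+\<^sub>i = c (\<nu>\<^sup>+\<^sub>j - \<nu>\<^sup>-\<^sub>i)\<close>, and rearranging, the vector
  \<open>\<sigma> = \<nu>\<^sup>+\<^sub>i - c \<nu>\<^sup>-\<^sub>i = \<nu>\<^sup>-\<^sub>j - c \<nu>\<^sup>+\<^sub>j\<close> lies in both \<open>f'\<^sub>i\<close> and \<open>f'\<^sub>j\<close>. Thus \<open>f'\<close> is a Legendre
  map, hence regular by the standing assumption on Legendre maps.

  For applicability take the \<open>1\<close>-form of the net \<open>s'\<^sup>+\<close> alone, \<open>\<nu>\<^sup>+\<^sub>j \<and> \<nu>\<^sup>+\<^sub>i\<close> on each edge. It is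
  closed and has values in \<open>\<Lambda>\<^sup>2 f'\<^sub>i\<^sub>j\<close>. Since \<open>c \<noteq> 0\<close>, the vectors \<open>\<nu>\<^sup>+\<^sub>i, \<nu>\<^sup>+\<^sub>j, \<sigma>\<close> span
  \<open>f'\<^sub>i + f'\<^sub>j\<close>, and regularity says that this space is \<open>3\<close>-dimensional, so
  \<open>\<nu>\<^sup>+\<^sub>i \<and> \<nu>\<^sup>+\<^sub>j \<and> \<sigma> \<noteq> 0\<close>.
\<close>

section \<open>Edges and quadrilaterals\<close>

lemma length_shift [simp]: "length (shift a t x) = length x"
  by (simp add: shift_def)

lemma shift_shift_minus [simp]: "a < length x \<Longrightarrow> shift a (- t) (shift a t x) = x"
  by (simp add: shift_def)

lemma shift_commute:
  "a \<noteq> b \<Longrightarrow> shift a s (shift b t x) = shift b t (shift a s x)"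
  by (simp add: shift_def list_update_swap)

lemma shift_Cons_Suc: "shift (Suc a) t (u # x) = u # shift a t x"
  by (simp add: shift_def)

lemma edgeI:
  assumes "x \<in> D" "y \<in> D" "a < length x" "t \<in> {1, -1}" "y = shift a t x"
  shows "edge D x y"
  unfolding edge_def using assms by blast

lemma quadrilateralI:
  assumes "i \<in> D" "j \<in> D" "k \<in> D" "l \<in> D" "a < length i" "b < length i" "a \<noteq> b"
    "s \<in> {1, -1}" "t \<in> {1, -1}"
    "j = shift a s i" "l = shift b t i" "k = shift b t (shift a s i)"
  shows "quadrilateral D i j k l"
  unfolding quadrilateral_def using assms by blast

lemma edge_sym:
  assumes "edge D x y"
  shows "edge D y x"
proof -
  obtain a t where "x \<in> D" "y \<in> D" "a < length x" "t \<in> {1, -1}" "y = shift a t x"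
    using assms unfolding edge_def by blast
  then show ?thesis
    by (intro edgeI[where a = a and t = "- t"]) auto
qed

lemma quadrilateral_edges:
  assumes "quadrilateral D i j k l"
  shows "edge D i j" "edge D j k" "edge D k l" "edge D l i"
proof -
  obtain a b s t where
    D: "i \<in> D" "j \<in> D" "k \<in> D" "l \<in> D" and
    ab: "a < length i" "b < length i" "a \<noteq> b" and
    st: "s \<in> {1, -1}" "t \<in> {1, -1}" and
    eqs: "j = shift a s i" "l = shift b t i" "k = shift b t (shift a s i)"
    using assms unfolding quadrilateral_def by blast
  show "edge D i j"
    using D ab st eqs by (intro edgeI[of _ _ _ a s]) auto
  show "edge D j k"
    using D ab st eqs by (intro edgeI[of _ _ _ b t]) auto
  have "edge D i l"
    using D ab st eqs by (intro edgeI[of _ _ _ b t]) auto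
  then show "edge D l i"
    by (rule edge_sym)
  have "edge D l k"
    using D ab st eqs shift_commute[OF ab(3), of s t i] by (intro edgeI[of _ _ _ a s]) auto
  then show "edge D k l"
    by (rule edge_sym)
qed

lemma double_Cons_iff: "t # x \<in> double D \<longleftrightarrow> t \<in> {0, 1} \<and> x \<in> D"
  by (auto simp: double_def)

lemma edge_double:
  assumes "edge D x y" "u \<in> {0, 1}"
  shows "edge (double D) (u # x) (u # y)"
proof -
  obtain a t where "x \<in> D" "y \<in> D" "a < length x" "t \<in> {1, -1}" "y = shift a t x"
    using assms(1) unfolding edge_def by blast
  then show ?thesis
    using assms(2) by (intro edgeI[of _ _ _ "Suc a" t]) (simp_all add: double_Cons_iff shift_Cons_Suc)
qed

lemma vertical_edge:
  assumes "x \<in> D"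
  shows "edge (double D) (0 # x) (1 # x)"
  by (rule edgeI[of _ _ _ 0 1]) (use assms in \<open>auto simp: double_Cons_iff shift_def\<close>)

lemma quadrilateral_double:
  assumes "quadrilateral D i j k l" "u \<in> {0, 1}"
  shows "quadrilateral (double D) (u # i) (u # j) (u # k) (u # l)"
proof -
  obtain a b s t where *:
    "i \<in> D" "j \<in> D" "k \<in> D" "l \<in> D" "a < length i" "b < length i" "a \<noteq> b"
    "s \<in> {1, -1}" "t \<in> {1, -1}"
    "j = shift a s i" "l = shift b t i" "k = shift b t (shift a s i)"
    using assms(1) unfolding quadrilateral_def by blast
  show ?thesis
    by (rule quadrilateralI[where a = "Suc a" and b = "Suc b" and s = s and t = t])
      (use * assms(2) in \<open>simp_all add: double_Cons_iff shift_Cons_Suc\<close>)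
qed

lemma vertical_quadrilateral:
  assumes "edge D x y"
  shows "quadrilateral (double D) (0 # x) (0 # y) (1 # y) (1 # x)"
proof -
  obtain a t where *: "x \<in> D" "y \<in> D" "a < length x" "t \<in> {1, -1}" "y = shift a t x"
    using assms unfolding edge_def by blast
  show ?thesis
    by (rule quadrilateralI[where a = "Suc a" and b = 0 and s = t and t = 1])
      (use * in \<open>simp_all add: double_Cons_iff shift_Cons_Suc\<close>, simp_all add: shift_def)
qed

lemma closed_form_restrict_double:
  assumes "closed_form (double D) \<eta>" "u \<in> {0, 1}"
  shows "closed_form D (\<lambda>y x. \<eta> (u # y) (u # x))"
  using assms edge_double[OF _ assms(2)] quadrilateral_double[OF _ assms(2)]
  unfolding closed_form_def one_form_def by blast


section \<open>Null lines and wedge products\<close>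

lemma wedge_commute: "wedge v w = - wedge w v"
  by (simp add: wedge_def vec_eq_iff)

lemma wedge_scaleR_self [simp]: "wedge (c *\<^sub>R v) v = 0"
  by (simp add: wedge_def vec_eq_iff)

lemma wedge_diff_diff:
  "wedge (x - y) (z - w) = wedge x z + wedge w x + wedge z y + wedge y w"
  by (simp add: wedge_def vec_eq_iff algebra_simps)

lemma wedge_eq_0D:
  assumes "wedge v w = 0" "w \<noteq> 0"
  obtains c where "v = c *\<^sub>R w"
proof -
  obtain b where b: "w $ b \<noteq> 0"
    using assms(2) by (auto simp: vec_eq_iff)
  have "v $ a * w $ b = v $ b * w $ a" for a
    using assms(1) by (simp add: wedge_def vec_eq_iff)
  with b have "v = (v $ b / w $ b) *\<^sub>R w"
    by (simp add: vec_eq_iff field_simps)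
  with that show thesis .
qed

lemma wedge3_eq_0_imp_in_span:
  assumes "wedge2v (wedge u v) w = 0" "wedge u v \<noteq> 0"
  shows "w \<in> span {u, v}"
proof -
  obtain a b where d: "u $ a * v $ b - u $ b * v $ a \<noteq> 0" (is "?d \<noteq> 0")
    using assms(2) by (auto simp: wedge_def vec_eq_iff)
  \<comment> \<open>Cramer's rule in the coordinates \<open>a, b\<close>: the \<open>(a, b, c)\<close>-minor of the triple product expresses
      the \<open>c\<close>-th coordinate of \<open>w\<close>.\<close>
  have minor: "?d * w $ c - (u $ a * v $ c - u $ c * v $ a) * w $ b
      + (u $ b * v $ c - u $ c * v $ b) * w $ a = 0" for c
    using assms(1) by (simp add: wedge2v_def wedge_def vec_eq_iff)
  have "?d * w $ c = (v $ b * w $ a - v $ a * w $ b) * u $ c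
      + (u $ a * w $ b - u $ b * w $ a) * v $ c" for c
    using minor[of c] by algebra
  then have "?d *\<^sub>R w = (v $ b * w $ a - v $ a * w $ b) *\<^sub>R u
      + (u $ a * w $ b - u $ b * w $ a) *\<^sub>R v" (is "_ = ?r")
    by (simp add: vec_eq_iff)
  moreover have "?r \<in> span {u, v}"
    by (intro span_add span_scale span_base) auto
  ultimately have "?d *\<^sub>R w \<in> span {u, v}"
    by simp
  then have "inverse ?d *\<^sub>R (?d *\<^sub>R w) \<in> span {u, v}"
    by (rule span_scale)
  with d show ?thesis
    by simp
qed

lemma null_line_eq_span:
  assumes "L \<in> null_lines B" "v \<in> L" "v \<noteq> 0"
  shows "L = span {v}"
proof -
  have "{v} \<subseteq> L" "independent {v}" "dim L = 1" "subspace L"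
    using assms by (auto simp: null_lines_def)
  then have "L \<subseteq> span {v}"
    by (intro card_ge_dim_independent) auto
  moreover have "span {v} \<subseteq> L"
    using \<open>{v} \<subseteq> L\<close> \<open>subspace L\<close> by (rule span_minimal)
  ultimately show ?thesis
    by blast
qed

lemma perp_null_lines_iff:
  assumes "bilinear B" "L \<in> null_lines B" "v \<in> L" "v \<noteq> 0" "M \<in> null_lines B" "w \<in> M" "w \<noteq> 0"
  shows "perp B L M \<longleftrightarrow> B v w = 0"
proof
  show "perp B L M \<Longrightarrow> B v w = 0"
    using assms(3,6) by (simp add: perp_def)
  assume "B v w = 0"
  then show "perp B L M"
    unfolding null_line_eq_span[OF assms(2-4)] null_line_eq_span[OF assms(5-7)] perp_def
    by (auto simp: span_singleton bilinear_lmul[OF assms(1)] bilinear_rmul[OF assms(1)])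
qed

lemma set_plus_span: "span S + span T = span (S \<union> T)"
  unfolding set_plus_def span_Un by auto

lemma dim_span_wedge_neq_0:
  assumes "wedge v w \<noteq> 0"
  shows "dim (span {v, w}) = 2"
proof -
  have "v \<notin> span {w}"
    using assms by (auto simp: span_singleton)
  moreover have "w \<noteq> 0"
    using assms wedge_scaleR_self[of 0 v] wedge_commute[of v w] by auto
  moreover have "v \<noteq> w"
    using assms wedge_scaleR_self[of 1 w] by auto
  ultimately have "independent {v, w}"
    by (simp add: independent_insert)
  then have "dim {v, w} = 2"
    using \<open>v \<noteq> w\<close> by (simp add: dim_eq_card_independent)
  then show ?thesis
    by simp
qed

lemma span_null_plane:
  assumes "bilinear B" "\<And>x y. B x y = B y x" "wedge v w \<noteq> 0" "B v v = 0" "B w w = 0" "B v w = 0"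
  shows "span {v, w} \<in> null_planes B"
proof -
  have "B x y = 0" if x: "x \<in> span {v, w}" and y: "y \<in> span {v, w}" for x y
  proof -
    obtain a b where x: "x = a *\<^sub>R v + b *\<^sub>R w"
      using x unfolding span_insert span_singleton by (auto simp: diff_eq_eq add.commute)
    obtain c d where y: "y = c *\<^sub>R v + d *\<^sub>R w"
      using y unfolding span_insert span_singleton by (auto simp: diff_eq_eq add.commute)
    show ?thesis
      unfolding x y using assms(2)[of w v] assms(4-6)
      by (simp add: bilinear_ladd[OF assms(1)] bilinear_radd[OF assms(1)]
          bilinear_lmul[OF assms(1)] bilinear_rmul[OF assms(1)])
  qed
  then show ?thesis
    using dim_span_wedge_neq_0[OF assms(3)] by (simp add: null_planes_def perp_def)
qed


section \<open>Moutard lifts\<close>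

locale lifted_isothermic_net =
  fixes B :: "real^'n \<Rightarrow> real^'n \<Rightarrow> real" and D s \<eta> \<mu>
  assumes bilinear: "bilinear B" and symmetric: "B x y = B y x"
    and isothermic: "isothermic_net B D s \<eta>" and lift: "moutard_lift D s \<eta> \<mu>"
begin

lemma null_line: "x \<in> D \<Longrightarrow> s x \<in> null_lines B"
  using isothermic by (simp add: isothermic_net_def regular_net_def)

lemma lift_in: "x \<in> D \<Longrightarrow> \<mu> x \<in> s x"
  and lift_neq_0: "x \<in> D \<Longrightarrow> \<mu> x \<noteq> 0"
  using lift by (auto simp: moutard_lift_def)

lemma lift_null: "x \<in> D \<Longrightarrow> B (\<mu> x) (\<mu> x) = 0"
  using null_line lift_in by (auto simp: null_lines_def)

lemma line_eq_span: "x \<in> D \<Longrightarrow> s x = span {\<mu> x}"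
  using null_line lift_in lift_neq_0 by (rule null_line_eq_span)

lemma perp_iff: "x \<in> D \<Longrightarrow> y \<in> D \<Longrightarrow> perp B (s x) (s y) \<longleftrightarrow> B (\<mu> x) (\<mu> y) = 0"
  by (intro perp_null_lines_iff bilinear null_line lift_in lift_neq_0)

lemma form_eq_wedge: "edge D x y \<Longrightarrow> \<eta> y x = wedge (\<mu> y) (\<mu> x)"
  using lift by (simp add: moutard_lift_def)

lemma wedge_lift_neq_0: "edge D x y \<Longrightarrow> wedge (\<mu> y) (\<mu> x) \<noteq> 0"
  using form_eq_wedge isothermic by (metis isothermic_net_def)

text \<open>Closedness says that \<open>(\<mu>\<^sub>k - \<mu>\<^sub>i) \<and> (\<mu>\<^sub>j - \<mu>\<^sub>l) = 0\<close>. Neither factor vanishes, since opposite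
  vertices are not orthogonal while each \<open>\<mu>\<^sub>x\<close> is null.\<close>

lemma moutard_equation:
  assumes quad: "quadrilateral D i j k l"
  obtains c where "c \<noteq> 0" "\<mu> k - \<mu> i = c *\<^sub>R (\<mu> j - \<mu> l)"
proof -
  note edges = quadrilateral_edges[OF quad]
  have D: "i \<in> D" "j \<in> D" "k \<in> D" "l \<in> D"
    using quad by (auto simp: quadrilateral_def)
  have "\<not> perp B (s i) (s k)" "\<not> perp B (s j) (s l)"
    using isothermic quad by (auto simp: isothermic_net_def regular_net_def)
  then have ne: "\<mu> i \<noteq> \<mu> k" "\<mu> j \<noteq> \<mu> l"
    using D lift_null by (auto simp: perp_iff)
  have "\<eta> i l + \<eta> l k + \<eta> k j + \<eta> j i = 0"
    using isothermic quad by (simp add: isothermic_net_def closed_form_def)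
  then have "wedge (\<mu> k - \<mu> i) (\<mu> j - \<mu> l) = 0"
    using edges by (simp add: form_eq_wedge wedge_diff_diff algebra_simps)
  then obtain c where c: "\<mu> k - \<mu> i = c *\<^sub>R (\<mu> j - \<mu> l)"
    using ne(2) by (auto elim: wedge_eq_0D)
  with ne(1) have "c \<noteq> 0"
    by auto
  with c that show thesis
    by blast
qed

text \<open>Expand the nullity of \<open>\<mu>\<^sub>k = \<mu>\<^sub>i + c (\<mu>\<^sub>j - \<mu>\<^sub>l)\<close> and divide by \<open>c\<close>.\<close>

lemma moutard_opposite_edges:
  assumes quad: "quadrilateral D i j k l"
  shows "B (\<mu> k) (\<mu> l) = B (\<mu> i) (\<mu> j)"
proof -
  have D: "i \<in> D" "j \<in> D" "k \<in> D" "l \<in> D"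
    using quad by (auto simp: quadrilateral_def)
  obtain c where "c \<noteq> 0" and c: "\<mu> k - \<mu> i = c *\<^sub>R (\<mu> j - \<mu> l)"
    using moutard_equation[OF quad] .
  note lin = bilinear_ladd[OF bilinear] bilinear_radd[OF bilinear] bilinear_lsub[OF bilinear]
    bilinear_rsub[OF bilinear] bilinear_lmul[OF bilinear] bilinear_rmul[OF bilinear]
  have k: "\<mu> k = \<mu> i + c *\<^sub>R (\<mu> j - \<mu> l)"
    using c by (simp add: algebra_simps)
  have "0 = B (\<mu> k) (\<mu> k)"
    using D by (simp add: lift_null)
  also have "\<dots> = 2 * c * (B (\<mu> i) (\<mu> j) - B (\<mu> i) (\<mu> l) - c * B (\<mu> j) (\<mu> l))"
    unfolding k using D symmetric[of "\<mu> j" "\<mu> i"] symmetric[of "\<mu> l" "\<mu> i"] symmetric[of "\<mu> l" "\<mu> j"]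
    by (simp add: lin lift_null algebra_simps)
  finally have "B (\<mu> i) (\<mu> j) = B (\<mu> i) (\<mu> l) + c * B (\<mu> j) (\<mu> l)"
    using \<open>c \<noteq> 0\<close> by simp
  also have "\<dots> = B (\<mu> k) (\<mu> l)"
    unfolding k using D by (simp add: lin lift_null)
  finally show ?thesis ..
qed

end

lemma moutard_lift_restrict_double:
  assumes "moutard_lift (double D) (u \<squnion>\<^sub>n v) \<eta> \<mu>"
    and "\<And>i j. edge D i j \<Longrightarrow> \<eta> (1 # j) (1 # i) = \<eta>v j i"
  shows "moutard_lift D v \<eta>v (\<lambda>x. \<mu> (1 # x))"
  unfolding moutard_lift_def
proof (intro conjI ballI allI impI)
  fix x assume "x \<in> D"
  then have "1 # x \<in> double D"
    by (simp add: double_Cons_iff)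
  then have "\<mu> (1 # x) \<in> (u \<squnion>\<^sub>n v) (1 # x) \<and> \<mu> (1 # x) \<noteq> 0"
    using assms(1) by (simp add: moutard_lift_def)
  then show "\<mu> (1 # x) \<in> v x" "\<mu> (1 # x) \<noteq> 0"
    by (auto simp: join_net_def)
next
  fix x y assume xy: "edge D x y"
  then have "edge (double D) (1 # x) (1 # y)"
    by (simp add: edge_double)
  then show "\<eta>v y x = wedge (\<mu> (1 # y)) (\<mu> (1 # x))"
    using assms(1) assms(2)[OF xy] unfolding moutard_lift_def by metis
qed


section \<open>The Legendre map of an isotropic pair\<close>

text \<open>If two nets are orthogonal at each point and \<open>\<nu>\<close> is a Moutard lift of their join, the planes
  that they span form a Legendre map with contact elements \<open>\<nu>\<^sup>+\<^sub>i - c \<nu>\<^sup>-\<^sub>i = \<nu>\<^sup>-\<^sub>j - c \<nu>\<^sup>+\<^sub>j\<close>, and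
  the \<open>1\<close>-form of the first net makes it applicable as soon as it is regular.\<close>

locale isotropic_pair =
  lifted_isothermic_net B "double D" "sp \<squnion>\<^sub>n sm" \<eta> \<nu>
  for B :: "real^'n \<Rightarrow> real^'n \<Rightarrow> real" and D sp sm \<eta> \<nu> +
  fixes f :: "point \<Rightarrow> (real^'n) set"
  assumes isotropic: "x \<in> D \<Longrightarrow> B (\<nu> (0 # x)) (\<nu> (1 # x)) = 0"
    and plane: "x \<in> D \<Longrightarrow> f x = sp x + sm x"
begin

lemma line_eq_span_pair:
  assumes "x \<in> D"
  shows "sp x = span {\<nu> (0 # x)}" "sm x = span {\<nu> (1 # x)}"
  using line_eq_span[of "0 # x"] line_eq_span[of "1 # x"] assms
  by (auto simp: double_Cons_iff join_net_def)

lemma plane_eq_span: "x \<in> D \<Longrightarrow> f x = span {\<nu> (0 # x), \<nu> (1 # x)}"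
  by (simp add: plane line_eq_span_pair set_plus_span insert_commute)

lemma wedge_vertical_neq_0: "x \<in> D \<Longrightarrow> wedge (\<nu> (0 # x)) (\<nu> (1 # x)) \<noteq> 0"
  using wedge_lift_neq_0[OF edge_sym[OF vertical_edge]] .

lemma lines_Int_eq_0:
  assumes "x \<in> D"
  shows "sp x \<inter> sm x = {0}"
proof -
  have "y = 0" if y: "y \<in> sp x" "y \<in> sm x" for y
  proof (rule ccontr)
    assume "y \<noteq> 0"
    obtain a where "y = a *\<^sub>R \<nu> (0 # x)"
      using y(1) assms by (auto simp: line_eq_span_pair span_singleton)
    moreover obtain b where b: "y = b *\<^sub>R \<nu> (1 # x)"
      using y(2) assms by (auto simp: line_eq_span_pair span_singleton)
    moreover note \<open>y \<noteq> 0\<close>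
    ultimately have "\<nu> (0 # x) = inverse a *\<^sub>R y"
      by auto
    also have "\<dots> = (inverse a * b) *\<^sub>R \<nu> (1 # x)"
      by (simp add: b)
    finally show False
      using wedge_vertical_neq_0[OF assms] by (metis wedge_scaleR_self)
  qed
  then show ?thesis
    using assms by (auto simp: line_eq_span_pair span_zero)
qed

lemma contact_element:
  assumes "edge D i j"
  obtains c where "c \<noteq> 0" "\<nu> (1 # j) - c *\<^sub>R \<nu> (0 # j) = \<nu> (0 # i) - c *\<^sub>R \<nu> (1 # i)"
proof -
  obtain c where "c \<noteq> 0" "\<nu> (1 # j) - \<nu> (0 # i) = c *\<^sub>R (\<nu> (0 # j) - \<nu> (1 # i))"
    using moutard_equation[OF vertical_quadrilateral[OF assms]] .
  with that show thesis
    by (simp add: algebra_simps)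
qed

lemma contact_in_planes:
  assumes "i \<in> D" "j \<in> D"
    and "\<nu> (1 # j) - c *\<^sub>R \<nu> (0 # j) = \<nu> (0 # i) - c *\<^sub>R \<nu> (1 # i)" (is "_ = ?\<sigma>")
  shows "?\<sigma> \<in> f i \<inter> f j"
proof
  show "?\<sigma> \<in> f i"
    unfolding plane_eq_span[OF assms(1)] by (intro span_diff span_scale span_base) auto
  show "?\<sigma> \<in> f j"
    unfolding plane_eq_span[OF assms(2)] assms(3)[symmetric]
    by (intro span_diff span_scale span_base) auto
qed

lemma legendre: "legendre_map B D f"
  unfolding legendre_map_def
proof (intro conjI ballI allI impI)
  fix x assume "x \<in> D"
  then show "f x \<in> null_planes B"
    unfolding plane_eq_span[OF \<open>x \<in> D\<close>]
    using bilinear symmetric wedge_vertical_neq_0 isotropic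
    by (intro span_null_plane) (auto simp: lift_null double_Cons_iff)
next
  fix i j assume ij: "edge D i j"
  then have D: "i \<in> D" "j \<in> D"
    by (auto simp: edge_def)
  obtain c where "c \<noteq> 0" and c: "\<nu> (1 # j) - c *\<^sub>R \<nu> (0 # j) = \<nu> (0 # i) - c *\<^sub>R \<nu> (1 # i)"
    using contact_element[OF ij] .
  have "\<nu> (0 # i) - c *\<^sub>R \<nu> (1 # i) \<noteq> 0"
    using wedge_vertical_neq_0[OF D(1)] by (metis right_minus_eq wedge_scaleR_self)
  with contact_in_planes[OF D c] show "f i \<inter> f j \<noteq> {0}"
    by blast
qed

lemma wedge_contact_neq_0:
  assumes ij: "edge D i j" and dim3: "dim (f i + f j) = 3"
  shows "\<exists>\<sigma> \<in> f i \<inter> f j. wedge2v (wedge (\<nu> (0 # i)) (\<nu> (0 # j))) \<sigma> \<noteq> 0"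
proof -
  have D: "i \<in> D" "j \<in> D"
    using ij by (auto simp: edge_def)
  obtain c where "c \<noteq> 0" and c: "\<nu> (1 # j) - c *\<^sub>R \<nu> (0 # j) = \<nu> (0 # i) - c *\<^sub>R \<nu> (1 # i)"
    using contact_element[OF ij] .
  define \<sigma> where "\<sigma> = \<nu> (0 # i) - c *\<^sub>R \<nu> (1 # i)"
  let ?S = "span {\<nu> (0 # i), \<nu> (0 # j)}"
  have ne: "wedge (\<nu> (0 # i)) (\<nu> (0 # j)) \<noteq> 0"
    using wedge_lift_neq_0[OF edge_double[OF edge_sym[OF ij]]] by simp
  have "wedge2v (wedge (\<nu> (0 # i)) (\<nu> (0 # j))) \<sigma> \<noteq> 0"
  proof
    \<comment> \<open>Otherwise \<open>\<sigma>\<close>, and hence both \<open>\<nu>\<^sup>-\<^sub>i\<close> and \<open>\<nu>\<^sup>-\<^sub>j\<close>, would lie in the plane of \<open>\<nu>\<^sup>+\<^sub>i, \<nu>\<^sup>+\<^sub>j\<close>.\<close>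
    assume "wedge2v (wedge (\<nu> (0 # i)) (\<nu> (0 # j))) \<sigma> = 0"
    then have \<sigma>: "\<sigma> \<in> ?S"
      using ne by (rule wedge3_eq_0_imp_in_span)
    have p: "\<nu> (0 # i) \<in> ?S" "\<nu> (0 # j) \<in> ?S"
      by (auto intro: span_base)
    have "\<nu> (1 # i) = inverse c *\<^sub>R (\<nu> (0 # i) - \<sigma>)"
      using \<open>c \<noteq> 0\<close> by (simp add: \<sigma>_def)
    then have mi: "\<nu> (1 # i) \<in> ?S"
      using \<sigma> p by (metis span_diff span_scale)
    have "\<nu> (1 # j) = \<sigma> + c *\<^sub>R \<nu> (0 # j)"
      using c by (simp add: \<sigma>_def algebra_simps)
    then have mj: "\<nu> (1 # j) \<in> ?S"
      using \<sigma> p by (metis span_add span_scale)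
    have "f i + f j \<subseteq> ?S"
      unfolding plane_eq_span[OF D(1)] plane_eq_span[OF D(2)] set_plus_span
      using p mi mj by (intro span_minimal) auto
    then have "dim (f i + f j) \<le> dim ?S"
      by (rule dim_subset)
    then show False
      using dim3 dim_span_wedge_neq_0[OF ne] by simp
  qed
  then show ?thesis
    using contact_in_planes[OF D c] unfolding \<sigma>_def by blast
qed

lemma applicable:
  assumes regular: "legendre_regular D f"
  shows "applicable_legendre_map B D f"
proof -
  define \<theta> where "\<theta> y x = \<eta> (0 # y) (0 # x)" for y x
  have "closed_form (double D) \<eta>"
    using isothermic by (simp add: isothermic_net_def)
  then have "closed_form D \<theta>"
    unfolding \<theta>_def by (rule closed_form_restrict_double) simp
  moreover have "\<theta> i j \<in> subspace_wedge (f i + f j) (f i + f j) \<and>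
      wedge2v (\<theta> i j) ` (f i \<inter> f j) \<noteq> {0}" if ij: "edge D i j" for i j
  proof -
    have D: "i \<in> D" "j \<in> D"
      using ij by (auto simp: edge_def)
    have \<theta>: "\<theta> i j = wedge (\<nu> (0 # i)) (\<nu> (0 # j))"
      unfolding \<theta>_def using edge_double[OF edge_sym[OF ij]] by (intro form_eq_wedge) simp
    have "\<nu> (0 # i) \<in> f i + f j" "\<nu> (0 # j) \<in> f i + f j"
      unfolding plane_eq_span[OF D(1)] plane_eq_span[OF D(2)] set_plus_span
      by (auto intro: span_base)
    then have "\<theta> i j \<in> subspace_wedge (f i + f j) (f i + f j)"
      unfolding \<theta> subspace_wedge_def by (blast intro: span_base)
    moreover have "dim (f i + f j) = 3"
      using regular ij by (simp add: legendre_regular_def)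
    then have "wedge2v (\<theta> i j) ` (f i \<inter> f j) \<noteq> {0}"
      using wedge_contact_neq_0[OF ij] unfolding \<theta> by blast
    ultimately show ?thesis ..
  qed
  ultimately show ?thesis
    using legendre regular unfolding applicable_legendre_map_def by blast
qed

end


section \<open>Darboux transforms of an isotropic pair\<close>

lemma has_label_infinity_imp_perp:
  assumes "bilinear B" "regular_net B D s" "x \<in> D" "y \<in> D" "has_label B D s \<eta> x y \<infinity>"
  shows "perp B (s x) (s y)"
proof -
  obtain \<mu> where \<mu>: "moutard_lift D s \<eta> \<mu>" and "\<infinity> = 1 / ereal (B (\<mu> x) (\<mu> y))"
    using assms(5) by (auto simp: has_label_def)
  then have "B (\<mu> x) (\<mu> y) = 0"
    by (auto simp: divide_ereal_def one_ereal_def split: if_splits)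
  moreover have "s x \<in> null_lines B" "s y \<in> null_lines B"
    using assms by (auto simp: regular_net_def)
  ultimately show ?thesis
    using \<mu> assms(1,3,4) perp_null_lines_iff[of B "s x" "\<mu> x" "s y" "\<mu> y"]
    by (simp add: moutard_lift_def)
qed

theorem proposition5p3:
  fixes B :: "real^'n \<Rightarrow> real^'n \<Rightarrow> real"
    and p q N :: nat
    and \<Sigma> :: "point set"
    and f sp sm sp' sm' f' :: "point \<Rightarrow> (real^'n) set"
    and \<eta>p \<eta>m \<eta> \<eta>' :: "point \<Rightarrow> point \<Rightarrow> real^'n^'n"
    and m :: real
  assumes "p \<ge> 1" and "q \<ge> 1" and "has_signature B (p + 1) (q + 1)"
    and "\<Sigma> \<subseteq> lattice N" and "simply_connected_domain \<Sigma>"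
    and "\<forall>i \<in> \<Sigma>. f i = sp i + sm i \<and> sp i \<inter> sm i = {0}"
    and "applicable_legendre_map B \<Sigma> f"
    and "darboux_pair_via B \<Sigma> sp \<eta>p sm \<eta>m \<infinity> \<eta>"
    and "m \<noteq> 0"
    and "\<forall>i j. edge (double \<Sigma>) i j \<longrightarrow> \<not> has_label B (double \<Sigma>) (sp \<squnion>\<^sub>n sm) \<eta> i j (ereal m)"
    and "darboux_pair B (double \<Sigma>) (sp \<squnion>\<^sub>n sm) \<eta> (sp' \<squnion>\<^sub>n sm') \<eta>' (ereal m)"
    and "\<forall>i \<in> \<Sigma>. f' i = sp' i + sm' i"
    and "legendre_map B \<Sigma> f' \<Longrightarrow> legendre_regular \<Sigma> f'"
  shows "(\<forall>i \<in> \<Sigma>. sp' i \<inter> sm' i = {0}) \<and> applicable_legendre_map B \<Sigma> f'"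
proof -
  let ?s = "sp \<squnion>\<^sub>n sm" and ?s' = "sp' \<squnion>\<^sub>n sm'"
  have bil: "bilinear B" and sym: "\<And>x y. B x y = B y x"
    using assms(3) by (auto simp: has_signature_def)
  obtain \<zeta> where
    iso': "isothermic_net B (double \<Sigma>) ?s' \<eta>'" and
    iso2: "isothermic_net B (double (double \<Sigma>)) (?s \<squnion>\<^sub>n ?s') \<zeta>" and
    \<zeta>: "\<And>x y. edge (double \<Sigma>) x y \<Longrightarrow> \<zeta> (1 # y) (1 # x) = \<eta>' y x" and
    label: "\<And>x. x \<in> double \<Sigma> \<Longrightarrow>
      has_label B (double (double \<Sigma>)) (?s \<squnion>\<^sub>n ?s') \<zeta> (0 # x) (1 # x) (ereal m)"
    using assms(11) unfolding darboux_pair_def darboux_pair_via_def by blast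
  show ?thesis
  proof (cases "\<Sigma> = {}")
    case True
    then show ?thesis
      by (simp add: applicable_legendre_map_def legendre_map_def legendre_regular_def
          closed_form_def one_form_def edge_def quadrilateral_def)
  next
    case False
    then have "\<exists>x. x \<in> double \<Sigma>"
      by (auto simp: double_def)
    \<comment> \<open>An edge label is computed from a lift, so a vertical label yields a lift of the whole net.\<close>
    then obtain \<mu> where \<mu>: "moutard_lift (double (double \<Sigma>)) (?s \<squnion>\<^sub>n ?s') \<zeta> \<mu>"
      using label unfolding has_label_def by blast
    interpret big: lifted_isothermic_net B "double (double \<Sigma>)" "?s \<squnion>\<^sub>n ?s'" \<zeta> \<mu>
      using bil sym iso2 \<mu> by unfold_locales
    have "B (\<mu> (1 # 0 # i)) (\<mu> (1 # 1 # i)) = 0" if i: "i \<in> \<Sigma>" for i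
    proof -
      have "perp B (?s (0 # i)) (?s (1 # i))"
        using assms(8) i bil unfolding darboux_pair_via_def isothermic_net_def
        by (intro has_label_infinity_imp_perp[of B "double \<Sigma>" ?s]) (auto simp: double_Cons_iff)
      moreover have "perp B (?s (0 # i)) (?s (1 # i)) \<longleftrightarrow> B (\<mu> (0 # 0 # i)) (\<mu> (0 # 1 # i)) = 0"
        using big.perp_iff[of "0 # 0 # i" "0 # 1 # i"] i
        by (simp add: double_Cons_iff join_net_def)
      ultimately show ?thesis
        using big.moutard_opposite_edges[OF vertical_quadrilateral[OF vertical_edge[OF i]]]
          sym[of "\<mu> (1 # 0 # i)"] by simp
    qed
    then interpret isotropic_pair B \<Sigma> sp' sm' \<eta>' "\<lambda>x. \<mu> (1 # x)" f'
      using bil sym iso' moutard_lift_restrict_double[OF \<mu> \<zeta>] assms(12)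
      by unfold_locales auto
    show ?thesis
      using lines_Int_eq_0 applicable[OF assms(13)[OF legendre]] by blast
  qed
qed

end
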